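(* Let $D(n)=n^{-1}|D\cap\{1,\dots,n\}|$. For $n\ge1$ write $n=\frac{1}{\sqrt5}c\phi^p$ with $p$ an integer and $\frac1{\sqrt5}\le c<\frac1{\sqrt5}\phi$. Then \[ D(n)=\begin{cases} 1-\frac12 c-\frac{1}{10c}+O(n^{-1/2}) & p\equiv 0 \pmod 4,\\ \frac{1}{2\phi}c+\frac{\phi}{10c}+O(n^{-1/2}) & p\equiv 1\pmod 4,\\ \frac12 c+\frac{1}{10c}+O(n^{-1/2}) & p\equiv 2\pmod 4,\\ 1-\frac{1}{2\phi}c-\frac{\phi}{10c}+O(n^{-1/2}) & p\equiv 3\pmod 4. \end{cases} \]
   Context: $\phi=(1+\sqrt5)/2$. For positive integers $a_1,a_2$, the $(a_1,a_2)$-Fibonacci walk is $w_k=w_k(a_1,a_2)$ with $w_1=a_1$, $w_2=a_2$, $w_{k+2}=w_{k+1}+w_k$. Let $s(n;a_1,a_2)$ be the integer $s$ with $w_s(a_1,a_2)=n$ ($-\infty$ if none), and $s(n)=\max_{a_1,a_2\ge1}s(n;a_1,a_2)$. A pair $(a_1,a_2)$ is $n$-good if $a_1,a_2\ge1$ and $s(n;a_1,a_2)=s(n)$; its walk is then called an $n$-slow Fibonacci walk. An integer $n\ge2$ is a down-integer if $w_{s(n)+1}=\lfloor\phi n\rfloor$ for some $n$-slow Fibonacci walk $(w_k)$; $D$ is the set of down-integers. The implied constants in $O(\cdot)$ are absolute. *)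

theory Defs
  imports "HOL-Library.Extended_Real"
begin

definition golden :: real where
  "golden = (1 + sqrt 5) / 2"

text \<open>Walks are indexed from 1; the value at index 0 is a dummy that is never used.\<close>
fun fib_walk :: "nat \<Rightarrow> nat \<Rightarrow> nat \<Rightarrow> nat" where
  "fib_walk a1 a2 0 = 0"
| "fib_walk a1 a2 (Suc 0) = a1"
| "fib_walk a1 a2 (Suc (Suc 0)) = a2"
| "fib_walk a1 a2 (Suc (Suc (Suc k))) = fib_walk a1 a2 (Suc (Suc k)) + fib_walk a1 a2 (Suc k)"

text \<open>For positive \<open>a1\<close>, \<open>a2\<close> the index of \<open>n\<close> in the walk is unique, except that \<open>n\<close> occurs
  at both indices 1 and 2 when \<open>a1 = a2 = n\<close>; the greater index is taken then. As 2 is below the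
  maximum \<open>walk_index_max n\<close> for every \<open>n \<ge> 2\<close>, this choice has no effect on
  \<open>down_integers\<close>.\<close>
definition walk_index :: "nat \<Rightarrow> nat \<Rightarrow> nat \<Rightarrow> ereal" where
  "walk_index n a1 a2 =
    (if \<exists>k\<ge>1. fib_walk a1 a2 k = n
     then ereal (real (GREATEST k. 1 \<le> k \<and> fib_walk a1 a2 k = n))
     else -\<infinity>)"

text \<open>The set is finite: its elements are \<open>-\<infinity>\<close> or integers between 1 and \<open>n + 1\<close>.\<close>
definition walk_index_max :: "nat \<Rightarrow> ereal" where
  "walk_index_max n = Max {walk_index n a1 a2 | a1 a2. 1 \<le> a1 \<and> 1 \<le> a2}"

definition good_pair :: "nat \<Rightarrow> nat \<Rightarrow> nat \<Rightarrow> bool" where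
  "good_pair n a1 a2 \<longleftrightarrow> 1 \<le> a1 \<and> 1 \<le> a2 \<and> walk_index n a1 a2 = walk_index_max n"

definition down_integers :: "nat set" where
  "down_integers = {n. 2 \<le> n \<and>
     (\<exists>a1 a2 s. good_pair n a1 a2 \<and> walk_index_max n = ereal (real s) \<and>
        int (fib_walk a1 a2 (s + 1)) = \<lfloor>golden * real n\<rfloor>)}"

definition down_density :: "nat \<Rightarrow> real" where
  "down_density n = real (card (down_integers \<inter> {1..n})) / real n"

end

theory Submission
  imports Defs "HOL-Number_Theory.Fib"
begin

text \<open>A pair that is slow for \<open>n\<close> satisfies \<open>a\<^sub>2 \<le> a\<^sub>1\<close>, so the sign of
  \<open>w\<^sub>s\<^sub>+\<^sub>1 - \<phi>n = (a\<^sub>2 - \<phi>a\<^sub>1)(-1/\<phi>)\<^sup>s\<^sup>-\<^sup>1\<close> depends only on the parity of \<open>s(n)\<close>, and \<open>n\<close> is a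
  down-integer iff \<open>s(n)\<close> is odd. The number of down-integers up to \<open>N\<close> is therefore an
  alternating sum over \<open>k \<ge> 1\<close> of \<open>R\<^sub>k\<close>, the number of \<open>n \<le> N\<close> of the form
  \<open>f b + g a\<close> with \<open>a, b \<ge> 1\<close>, where \<open>f = F\<^sub>k\<^sub>+\<^sub>1\<close> and \<open>g = F\<^sub>k\<close>. As \<open>f\<close> and \<open>g\<close> are
  coprime, \<open>R\<^sub>k\<close> counts the lattice points with \<open>a \<le> f\<close>, which gives \<open>N - fg/2 + O(f)\<close> if
  \<open>fg \<le> N\<close> and \<open>N\<^sup>2/(2fg) + O(N/g)\<close> otherwise. With \<open>fg = \<phi>\<^sup>2\<^sup>k\<^sup>+\<^sup>1/5 + O(1)\<close> both ranges become
  alternating geometric series, and the errors sum to \<open>O(\<surd>N)\<close>.\<close>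

subsection \<open>The golden ratio and Fibonacci numbers\<close>

lemma golden_gt_1: "1 < golden" and golden_lt_2: "golden < 2"
  and golden_square: "golden * golden = golden + 1"
  and sqrt5_golden: "sqrt 5 = 2 * golden - 1"
proof -
  have "1 < sqrt 5" "sqrt 5 < 3" by (auto intro: real_less_rsqrt real_less_lsqrt)
  then show "1 < golden" "golden < 2" by (simp_all add: golden_def)
  show "golden * golden = golden + 1" by (simp add: golden_def field_simps)
  show "sqrt 5 = 2 * golden - 1" by (simp add: golden_def field_simps)
qed

lemma golden_power_ge_1: "1 \<le> golden ^ k"
  using golden_gt_1 by simp

lemma golden_pos: "0 < golden"
  using golden_gt_1 by simp

lemma golden_power_pos: "0 < golden ^ k"
  using golden_pos by simp

text \<open>Stated for any root of \<open>x * x = x + 1\<close>, because it serves both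
  \<open>golden\<close> and its conjugate \<open>1 - golden\<close>.\<close>

lemma power_Suc_Suc_of_square:
  fixes x :: "'a::comm_semiring_1"
  assumes "x * x = x + 1"
  shows "x ^ Suc (Suc k) = x ^ Suc k + x ^ k"
  by (simp add: assms distrib_right flip: mult.assoc)

lemma conjugate_square: "(1 - golden) * (1 - golden) = (1 - golden) + 1"
  using golden_square by (simp add: algebra_simps)

lemmas golden_Suc_Suc = power_Suc_Suc_of_square[OF golden_square]
lemmas conjugate_Suc_Suc = power_Suc_Suc_of_square[OF conjugate_square]

lemma golden_conjugate: "golden * (1 - golden) = -1"
  using golden_square by (simp add: algebra_simps)

lemma fib_le_golden: "real (fib (Suc k)) \<le> golden ^ k"
proof (induction k rule: fib.induct)
  case (3 k)
  then show ?case using golden_Suc_Suc[of k] by (simp only: fib.simps of_nat_add)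
qed (use golden_gt_1 in auto)

lemma golden_le_fib: "golden ^ k \<le> real (fib (Suc (Suc k)))"
proof (induction k rule: fib.induct)
  case (3 k)
  then show ?case using golden_Suc_Suc[of k] by (simp only: fib.simps of_nat_add)
qed (use golden_lt_2 in auto)

lemma binet: "sqrt 5 * real (fib k) = golden ^ k - (1 - golden) ^ k"
proof (induction k rule: fib.induct)
  case (3 k)
  then show ?case using golden_Suc_Suc[of k] conjugate_Suc_Suc[of k]
    by (simp only: fib.simps of_nat_add distrib_left)
qed (use sqrt5_golden in auto)

text \<open>In the product of two Binet formulas the cross terms collapse to
  \<open>(-1) ^ k\<close>, because \<open>golden\<close> and its conjugate have product -1 and sum
  1. With this the product of the two coefficients can be traded for an exact geometric
  sequence.\<close>

lemma fib_consecutive_product: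
  "\<bar>5 * (real (fib (Suc k)) * real (fib k)) - golden ^ (2 * k + 1)\<bar> \<le> 2"
proof -
  define q where "q = 1 - golden"
  have "5 * (real (fib (Suc k)) * real (fib k))
      = (sqrt 5 * real (fib (Suc k))) * (sqrt 5 * real (fib k))"
    by simp
  also have "\<dots> = (golden ^ Suc k - q ^ Suc k) * (golden ^ k - q ^ k)"
    unfolding binet q_def ..
  also have "\<dots> = golden ^ (2 * k + 1) + q ^ (2 * k + 1) - (golden * q) ^ k * (golden + q)"
    by (simp add: algebra_simps power_mult_distrib mult_2_right power_add)
  also have "\<dots> = golden ^ (2 * k + 1) + q ^ (2 * k + 1) - (-1) ^ k"
    using golden_conjugate by (simp add: q_def)
  finally have *: "5 * (real (fib (Suc k)) * real (fib k)) - golden ^ (2 * k + 1)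
      = q ^ (2 * k + 1) - (-1) ^ k" by simp
  have "\<bar>q\<bar> \<le> 1" using golden_gt_1 golden_lt_2 by (simp add: q_def)
  then have "\<bar>q ^ (2 * k + 1)\<bar> \<le> 1" unfolding power_abs by (intro power_le_one) auto
  moreover have "\<bar>(-1) ^ k :: real\<bar> = 1" by simp
  ultimately show ?thesis unfolding * by linarith
qed

lemma fib_walk_fib: "fib_walk a b (Suc (Suc k)) = fib (Suc k) * b + fib k * a"
  by (induction k rule: fib.induct) (simp_all add: algebra_simps)

text \<open>This linear form in two consecutive entries is an eigenvector of the recurrence: each
  step multiplies it by the other root \<open>1 - golden\<close>.\<close>

lemma fib_walk_golden:
  "real (fib_walk a b (Suc (Suc k))) - golden * real (fib_walk a b (Suc k))
    = (real b - golden * real a) * (1 - golden) ^ k"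
proof (induction k)
  case (Suc k)
  have "real (fib_walk a b (Suc (Suc (Suc k)))) - golden * real (fib_walk a b (Suc (Suc k)))
    = (1 - golden) * real (fib_walk a b (Suc (Suc k))) + real (fib_walk a b (Suc k))"
    by (cases k) (simp_all add: algebra_simps)
  also have "\<dots> = (1 - golden) *
      (real (fib_walk a b (Suc (Suc k))) - golden * real (fib_walk a b (Suc k)))"
    using golden_conjugate
    by (simp add: right_diff_distrib mult.commute[of "1 - golden" golden] flip: mult.assoc)
  finally show ?case using Suc by simp
qed simp

text \<open>From the second entry on, each step adds a positive entry. The linear growth bounds the
  indices at which \<open>n\<close> can occur, so that \<open>GREATEST\<close> and
  \<open>Max\<close> are meaningful.\<close>

lemma fib_walk_ge:
  assumes "1 \<le> a" "1 \<le> b"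
  shows "k \<le> fib_walk a b (Suc k)"
proof (induction k rule: fib.induct)
  case (3 k)
  have "1 \<le> fib_walk a b (Suc k)"
  proof (cases k)
    case (Suc j)
    have "1 * 1 \<le> fib (Suc j) * b"
      using assms(2) fib_neq_0_nat[of "Suc j"] by (intro mult_le_mono) auto
    then show ?thesis unfolding Suc fib_walk_fib by linarith
  qed (use assms in simp)
  then show ?case using 3 by simp
qed (use assms in auto)

subsection \<open>Down-integers and the parity of the walk length\<close>

definition represents :: "nat \<Rightarrow> nat \<Rightarrow> nat \<Rightarrow> nat \<Rightarrow> bool" where
  "represents k n a b \<longleftrightarrow> 1 \<le> a \<and> 1 \<le> b \<and> n = fib (Suc k) * b + fib k * a"

definition representable :: "nat \<Rightarrow> nat \<Rightarrow> bool" where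
  "representable k n \<longleftrightarrow> (\<exists>a b. represents k n a b)"

lemma representsI_fib_walk:
  "1 \<le> a \<Longrightarrow> 1 \<le> b \<Longrightarrow> fib_walk a b (Suc (Suc k)) = n \<Longrightarrow> represents k n a b"
  by (auto simp: represents_def fib_walk_fib)

text \<open>Dropping the first entry of a walk lowers the index of every later entry by one. The
  next lemma is the inverse: it prefixes the entry \<open>b - a\<close>, which is positive when
  \<open>a < b\<close>.\<close>

lemma represents_Suc: "represents (Suc k) n a b \<Longrightarrow> represents k n b (a + b)"
  by (auto simp: represents_def algebra_simps)

lemma represents_Suc_I: "represents k n a b \<Longrightarrow> a < b \<Longrightarrow> represents (Suc k) n (b - a) a"
proof -
  assume *: "represents k n a b" "a < b"
  then obtain d where "b = a + d" using less_imp_add_positive by blast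
  with * show ?thesis by (auto simp: represents_def algebra_simps)
qed

lemma representable_antimono: "representable k n \<Longrightarrow> j \<le> k \<Longrightarrow> representable j n"
proof (induction k)
  case (Suc k)
  then show ?case unfolding representable_def by (metis le_Suc_eq represents_Suc)
qed auto

lemma representable_imp_fib_le:
  assumes "representable k n"
  shows "fib (Suc (Suc k)) \<le> n"
proof -
  obtain a b where "1 \<le> a" "1 \<le> b" "n = fib (Suc k) * b + fib k * a"
    using assms by (auto simp: representable_def represents_def)
  then show ?thesis by (simp add: add_mono)
qed

lemma representable_imp_le:
  assumes "representable k n"
  shows "k \<le> n"
proof -
  have "k \<le> fib (Suc (Suc k))"
    using fib_walk_ge[of 1 1 "Suc k"] by (simp add: fib_walk_fib)
  then show ?thesis using representable_imp_fib_le[OF assms] by simp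
qed

lemma representable_0: "1 \<le> n \<Longrightarrow> representable 0 n"
  unfolding representable_def represents_def by (intro exI[of _ 1] exI[of _ n]) simp

text \<open>Replacing \<open>(a, b)\<close> by \<open>(a - fib (Suc k), b + fib k)\<close> leaves
  \<open>n\<close> unchanged, so in a representation with least \<open>a\<close> this step must be
  impossible.\<close>

lemma represents_reduce:
  assumes "representable k n"
  obtains a b where "represents k n a b" "a \<le> fib (Suc k)"
proof -
  define a where "a = (LEAST a. \<exists>b. represents k n a b)"
  have ex: "\<exists>a. \<exists>b. represents k n a b" using assms by (simp add: representable_def)
  obtain b where b: "represents k n a b" using LeastI_ex[OF ex] by (auto simp: a_def)
  have "a \<le> fib (Suc k)"
  proof (rule ccontr)
    assume "\<not> a \<le> fib (Suc k)"
    then obtain d where d: "a = fib (Suc k) + d" "0 < d"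
      by (metis less_imp_add_positive not_le)
    have "represents k n d (b + fib k)"
      using b d by (auto simp: represents_def algebra_simps)
    then have "a \<le> d" unfolding a_def by (intro Least_le) auto
    then show False using d fib_neq_0_nat[of "Suc k"] by simp
  qed
  with b show ?thesis by (rule that)
qed

text \<open>This is \<open>s(n) - 2\<close>, because \<open>represents k n a b\<close> says that \<open>n\<close> is the entry with index \<open>k + 2\<close>.\<close>
definition slowness :: "nat \<Rightarrow> nat" where
  "slowness n = (GREATEST k. representable k n)"

text \<open>The admissible \<open>k\<close> include 0, are bounded by \<open>n\<close> and are
  closed downwards, so they form an initial segment that is determined by its greatest
  element.\<close>

lemma representable_iff_le_slowness:
  assumes "1 \<le> n"
  shows "representable k n \<longleftrightarrow> k \<le> slowness n"
proof
  show "representable k n \<Longrightarrow> k \<le> slowness n"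
    unfolding slowness_def by (rule Greatest_le_nat[where b = n]) (auto dest: representable_imp_le)
  have "representable (slowness n) n"
    unfolding slowness_def
    by (rule GreatestI_nat[where b = n]) (use representable_0[OF assms] in \<open>auto dest: representable_imp_le\<close>)
  then show "k \<le> slowness n \<Longrightarrow> representable k n" by (rule representable_antimono)
qed

section \<open>The maximal walk index and the slow pairs\<close>

lemma walk_index_cases:
  assumes "1 \<le> a" "1 \<le> b"
  obtains "walk_index n a b = -\<infinity>" "\<And>k. 1 \<le> k \<Longrightarrow> fib_walk a b k \<noteq> n"
  | j where "1 \<le> j" "fib_walk a b j = n" "walk_index n a b = ereal (real j)" "j \<le> n + 1"
      "\<And>k. 1 \<le> k \<Longrightarrow> fib_walk a b k = n \<Longrightarrow> k \<le> j"
proof (cases "\<exists>k\<ge>1. fib_walk a b k = n")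
  case True
  define j where "j = (GREATEST k. 1 \<le> k \<and> fib_walk a b k = n)"
  have bound: "k \<le> n + 1" if "1 \<le> k \<and> fib_walk a b k = n" for k
    using that fib_walk_ge[OF assms, of "k - 1"] by simp
  have j: "1 \<le> j \<and> fib_walk a b j = n"
    unfolding j_def
    by (rule GreatestI_ex_nat[where P = "\<lambda>k. 1 \<le> k \<and> fib_walk a b k = n" and b = "n + 1"])
      (use True bound in auto)
  have "k \<le> j" if "1 \<le> k" "fib_walk a b k = n" for k
    unfolding j_def
    by (rule Greatest_le_nat[where P = "\<lambda>k. 1 \<le> k \<and> fib_walk a b k = n" and b = "n + 1"])
      (use that bound in auto)
  moreover have "walk_index n a b = ereal (real j)"
    using True by (simp add: walk_index_def j_def)
  ultimately show thesis using that(2)[of j] j bound[OF j] by blast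
next
  case False
  then show thesis by (intro that(1)) (auto simp: walk_index_def)
qed

text \<open>A lower bound is enough here: for \<open>k = slowness n\<close> the matching upper bound
  is \<open>walk_index_le\<close>.\<close>

lemma walk_index_ge:
  assumes "represents k n a b"
  shows "ereal (real (k + 2)) \<le> walk_index n a b"
proof -
  have ab: "1 \<le> a" "1 \<le> b" and w: "fib_walk a b (k + 2) = n"
    using assms by (auto simp: represents_def fib_walk_fib)
  from ab show ?thesis
  proof (cases rule: walk_index_cases[where n = n])
    case 1
    from 1(2)[of "k + 2"] w show ?thesis by simp
  next
    case (2 j)
    from 2(3) 2(5)[of "k + 2"] w show ?thesis by simp
  qed
qed

lemma walk_index_le:
  assumes "1 \<le> n" "1 \<le> a" "1 \<le> b"
  shows "walk_index n a b \<le> ereal (real (slowness n + 2))"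
  using assms(2,3)
proof (cases rule: walk_index_cases[where n = n])
  case (2 j)
  have "j \<le> slowness n + 2"
  \<comment> \<open>\<open>represents\<close> does not speak of index 1, but indices up to 2 are
    trivially at most \<open>slowness n + 2\<close>.\<close>
  proof (cases "j \<le> 2")
    case False
    then obtain k where k: "j = Suc (Suc k)" by (metis add_2_eq_Suc le_add_diff_inverse nle_le)
    then have "representable k n"
      using 2(2) assms representsI_fib_walk unfolding representable_def by blast
    then show ?thesis using representable_iff_le_slowness[OF assms(1)] k by simp
  qed simp
  then show ?thesis using 2 by simp
qed simp

lemma walk_index_max_eq:
  assumes "1 \<le> n"
  shows "walk_index_max n = ereal (real (slowness n + 2))"
proof -
  let ?W = "{walk_index n a b | a b. 1 \<le> a \<and> 1 \<le> b}"
  \<comment> \<open>There are infinitely many pairs, and \<open>Max\<close> needs a finite set of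
    values.\<close>
  have "?W \<subseteq> insert (-\<infinity>) ((\<lambda>j. ereal (real j)) ` {..n + 1})"
  proof
    fix x assume "x \<in> ?W"
    then obtain a b where "1 \<le> a" "1 \<le> b" and x: "x = walk_index n a b" by auto
    then show "x \<in> insert (-\<infinity>) ((\<lambda>j. ereal (real j)) ` {..n + 1})"
      by (cases rule: walk_index_cases[where n = n]) auto
  qed
  then have fin: "finite ?W" by (rule finite_subset) simp
  obtain a b where ab: "represents (slowness n) n a b"
    using representable_iff_le_slowness[OF assms, of "slowness n"] by (auto simp: representable_def)
  then have 1: "1 \<le> a" "1 \<le> b" by (auto simp: represents_def)
  have "walk_index n a b = ereal (real (slowness n + 2))"
    using walk_index_ge[OF ab] walk_index_le[OF assms 1] by simp
  then have "ereal (real (slowness n + 2)) \<in> ?W" using 1 by force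
  then show ?thesis unfolding walk_index_max_def
    using walk_index_le[OF assms] by (intro Max_eqI[OF fin]) auto
qed

lemma good_pair_iff:
  assumes "1 \<le> n"
  shows "good_pair n a b \<longleftrightarrow> represents (slowness n) n a b"
proof
  assume r: "represents (slowness n) n a b"
  then have "1 \<le> a" "1 \<le> b" by (auto simp: represents_def)
  then show "good_pair n a b"
    unfolding good_pair_def walk_index_max_eq[OF assms]
    using walk_index_ge[OF r] walk_index_le[OF assms] by (simp add: antisym)
next
  assume g: "good_pair n a b"
  then have ab: "1 \<le> a" "1 \<le> b" by (auto simp: good_pair_def)
  have i: "walk_index n a b = ereal (real (slowness n + 2))"
    using g by (simp add: good_pair_def walk_index_max_eq[OF assms])
  from ab show "represents (slowness n) n a b"
  proof (cases rule: walk_index_cases[where n = n])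
    case 1
    then show ?thesis using i by simp
  next
    case (2 j)
    then have "j = Suc (Suc (slowness n))" using i by simp
    then show ?thesis using 2 ab representsI_fib_walk by blast
  qed
qed

text \<open>Since a slow pair has \<open>b \<le> a\<close>, the next entry minus
  \<open>golden * n\<close> has the sign of \<open>-((1 - golden) ^ Suc k)\<close>. For odd
  \<open>k\<close> the entry lies below \<open>golden * n\<close>, and some slow pair brings it
  within 1; for even \<open>k\<close> it lies above and cannot be the floor.\<close>

lemma down_integers_iff:
  assumes "1 \<le> n"
  shows "n \<in> down_integers \<longleftrightarrow> odd (slowness n)"
proof -
  define k where "k = slowness n"
  define D where "D a b \<longleftrightarrow> int (fib_walk a b (Suc (Suc (Suc k)))) = \<lfloor>golden * real n\<rfloor>" for a b
  have mem: "n \<in> down_integers \<longleftrightarrow> 2 \<le> n \<and> (\<exists>a b. represents k n a b \<and> D a b)"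
  proof -
    have "ereal (real (slowness n + 2)) = ereal (real s) \<longleftrightarrow> s = Suc (Suc k)" for s
      by (auto simp: k_def)
    then show ?thesis
      unfolding down_integers_def D_def k_def
      by (simp add: walk_index_max_eq[OF assms] good_pair_iff[OF assms] k_def)
  qed
  have diff: "real (fib_walk a b (Suc (Suc (Suc k)))) - golden * real n
      = - (golden * real a - real b) * (1 - golden) ^ Suc k"
    and pos: "0 < golden * real a - real b" if r: "represents k n a b" for a b
  proof -
    have "fib_walk a b (Suc (Suc k)) = n" using r by (simp add: represents_def fib_walk_fib)
    then show "real (fib_walk a b (Suc (Suc (Suc k)))) - golden * real n
      = - (golden * real a - real b) * (1 - golden) ^ Suc k"
      using fib_walk_golden[of a b "Suc k"] by simp
    \<comment> \<open>Otherwise the walk could be extended backwards by the entry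
      \<open>b - a\<close>, against the maximality of \<open>k\<close>.\<close>
    have "\<not> a < b"
    proof
      assume "a < b"
      then have "representable (Suc k) n"
        using represents_Suc_I[OF r] by (auto simp: representable_def)
      then show False using representable_iff_le_slowness[OF assms] by (simp add: k_def)
    qed
    moreover have "real a < golden * real a" using r golden_gt_1 by (simp add: represents_def)
    ultimately show "0 < golden * real a - real b" by simp
  qed
  show ?thesis
  proof (cases "odd k")
    case True
    have k: "1 \<le> k" using True by (cases k) auto
    have n: "2 \<le> n"
    proof -
      have "representable 1 n"
        using k representable_iff_le_slowness[OF assms] by (simp add: k_def)
      from representable_imp_fib_le[OF this] show ?thesis by (simp add: numeral_2_eq_2)
    qed
    have "representable k n" using representable_iff_le_slowness[OF assms] by (simp add: k_def)
    \<comment> \<open>The floor needs a distance below 1. The reduced pair has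
      \<open>a \<le> golden ^ k\<close>, which compensates for the factor
      \<open>q ^ Suc k = 1 / golden ^ Suc k\<close>.\<close>
    then obtain a b where r: "represents k n a b" and a: "a \<le> fib (Suc k)"
      by (rule represents_reduce)
    define q where "q = golden - 1"
    have "(1 - golden) ^ Suc k = q ^ Suc k"
      using True unfolding q_def by (metis even_Suc minus_diff_eq power_minus_even)
    then have d: "golden * real n - real (fib_walk a b (Suc (Suc (Suc k))))
        = (golden * real a - real b) * q ^ Suc k"
      using diff[OF r] by (simp only: mult_minus_left)
    have "golden * q = 1" using golden_square by (simp add: q_def algebra_simps)
    then have q: "0 < q ^ Suc k" "golden ^ Suc k * q ^ Suc k = 1"
      using golden_gt_1 by (simp_all add: q_def flip: power_mult_distrib del: power_Suc)
    have "real a \<le> golden ^ k" using a fib_le_golden[of k] by linarith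
    then have "golden * real a \<le> golden ^ Suc k" using golden_pos by simp
    moreover have "0 < real b" using r by (simp add: represents_def)
    ultimately have "golden * real a - real b < golden ^ Suc k" by linarith
    then have "(golden * real a - real b) * q ^ Suc k < golden ^ Suc k * q ^ Suc k"
      using q by (intro mult_strict_right_mono)
    moreover have "0 < (golden * real a - real b) * q ^ Suc k"
      using pos[OF r] q(1) by (rule mult_pos_pos)
    ultimately have "D a b"
      unfolding D_def using d q(2) by (intro floor_unique[symmetric]) auto
    then show ?thesis using mem r n True by (auto simp: k_def)
  next
    case False
    have "\<not> D a b" if r: "represents k n a b" for a b
    proof -
      have "(1 - golden) ^ Suc k < 0"
        using False golden_gt_1 by (simp add: power_less_zero_eq del: power_Suc)
      then have "0 < - (golden * real a - real b) * (1 - golden) ^ Suc k"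
        using pos[OF r] by (intro mult_neg_neg) auto
      then have "golden * real n < real (fib_walk a b (Suc (Suc (Suc k))))"
        using diff[OF r] by linarith
      then show ?thesis unfolding D_def by linarith
    qed
    then show ?thesis using mem False by (auto simp: k_def)
  qed
qed

subsection \<open>Counting representable integers\<close>

definition representable_count :: "nat \<Rightarrow> nat \<Rightarrow> nat" where
  "representable_count k N = card {n \<in> {1..N}. representable k n}"

lemma sum_minus_one_power: "(\<Sum>k = 1..s. (- 1) ^ (k + 1)) = (of_bool (odd s) :: real)"
  by (induction s) auto

text \<open>The indicator of an odd slowness \<open>s\<close> is the alternating sum of
  \<open>s\<close> ones, one for each \<open>k\<close> from 1 to \<open>s\<close>, and these are the
  positive \<open>k\<close> for which \<open>n\<close> is representable. Interchanging the sums
  gives the counts; the bound on \<open>N\<close> ensures that no slowness exceeds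
  \<open>K\<close>.\<close>

lemma card_down_integers:
  assumes "N < fib (Suc (Suc (Suc K)))"
  shows "real (card (down_integers \<inter> {1..N}))
    = (\<Sum>k = 1..K. (- 1) ^ (k + 1) * real (representable_count k N))"
proof -
  have indicator: "of_bool (n \<in> down_integers)
      = (\<Sum>k = 1..K. (- 1) ^ (k + 1) * of_bool (representable k n) :: real)"
    if n: "n \<in> {1..N}" for n
  proof -
    have n1: "1 \<le> n" using n by simp
    have "slowness n \<le> K"
    proof (rule ccontr)
      assume "\<not> slowness n \<le> K"
      then have "representable (Suc K) n" using representable_iff_le_slowness[OF n1] by simp
      from representable_imp_fib_le[OF this] show False using n assms by simp
    qed
    then have "(\<Sum>k = 1..K. (- 1) ^ (k + 1) * of_bool (representable k n) :: real)
        = (\<Sum>k = 1..slowness n. (- 1) ^ (k + 1))"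
      using representable_iff_le_slowness[OF n1] by (intro sum.mono_neutral_cong_right) auto
    then show ?thesis using sum_minus_one_power down_integers_iff[OF n1] by simp
  qed
  have count: "(\<Sum>n\<in>{1..N}. of_bool (P n) :: real) = real (card {n \<in> {1..N}. P n})" for P
    by (simp add: of_bool_def Int_def flip: sum.inter_filter)
  have "real (card (down_integers \<inter> {1..N})) = real (card {n \<in> {1..N}. n \<in> down_integers})"
    by (intro arg_cong[where f = "\<lambda>A. real (card A)"]) auto
  also have "\<dots> = (\<Sum>n\<in>{1..N}. of_bool (n \<in> down_integers))" unfolding count ..
  also have "\<dots> = (\<Sum>n\<in>{1..N}. \<Sum>k = 1..K. (- 1) ^ (k + 1) * of_bool (representable k n))"
    using indicator by (rule sum.cong[OF refl])
  also have "\<dots> = (\<Sum>k = 1..K. (- 1) ^ (k + 1) * (\<Sum>n\<in>{1..N}. of_bool (representable k n)))"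
    unfolding sum_distrib_left by (rule sum.swap)
  finally show ?thesis unfolding count representable_count_def .
qed

text \<open>The sum counts, column by column, the lattice points with
  \<open>1 \<le> a \<le> fib (Suc k)\<close>. Every representable number has such a point by
  \<open>represents_reduce\<close>, and only one, because the coefficients are coprime and two
  values of \<open>a\<close> in this range differ by less than \<open>fib (Suc k)\<close>.\<close>

lemma representable_count_eq_sum:
  "representable_count k N = (\<Sum>a = 1..fib (Suc k). (N - fib k * a) div fib (Suc k))"
proof -
  define f g where "f = fib (Suc k)" and "g = fib k"
  have f: "0 < f" using fib_neq_0_nat by (simp add: f_def)
  define P where "P = (SIGMA a:{1..f}. {1..(N - g * a) div f})"
  have P: "(a, b) \<in> P \<longleftrightarrow> 1 \<le> a \<and> a \<le> f \<and> 1 \<le> b \<and> f * b + g * a \<le> N" for a b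
  proof -
    have "b \<le> (N - g * a) div f \<longleftrightarrow> f * b + g * a \<le> N" if "1 \<le> b"
    proof -
      \<comment> \<open>Positivity of \<open>f * b\<close> rules out the truncated case of the
        natural subtraction \<open>N - g * a\<close>.\<close>
      have "0 < f * b" using f that by simp
      then have "f * b \<le> N - g * a \<longleftrightarrow> f * b + g * a \<le> N" by linarith
      then show ?thesis using f by (simp add: less_eq_div_iff_mult_less_eq mult.commute)
    qed
    then show ?thesis unfolding P_def by auto
  qed
  define h where "h = (\<lambda>(a, b). f * b + g * a)"
  have "{n \<in> {1..N}. representable k n} = h ` P"
  proof (intro equalityI subsetI)
    fix n assume n: "n \<in> {n \<in> {1..N}. representable k n}"
    then obtain a b where "represents k n a b" "a \<le> fib (Suc k)"
      by (auto elim: represents_reduce)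
    with n show "n \<in> h ` P"
      by (intro image_eqI[of _ _ "(a, b)"]) (auto simp: P h_def represents_def f_def g_def)
  next
    fix n assume "n \<in> h ` P"
    then obtain a b where ab: "(a, b) \<in> P" and n: "n = f * b + g * a" by (auto simp: h_def)
    then have "represents k n a b" by (auto simp: P represents_def f_def g_def)
    moreover have "0 < n" using ab f by (auto simp: n P)
    moreover have "n \<le> N" using ab by (simp add: n P)
    ultimately show "n \<in> {n \<in> {1..N}. representable k n}" by (auto simp: representable_def)
  qed
  moreover have "inj_on h P"
  proof (rule inj_onI, clarify)
    have *: "a = a' \<and> b = b'" if "(a, b) \<in> P" "(a', b') \<in> P" "f * b + g * a = f * b' + g * a'" "a \<le> a'"
      for a b a' b'
    proof -
      have "g * (a' - a) = f * b - f * b'" using that(3,4) by (simp add: diff_mult_distrib2)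
      then have "f dvd g * (a' - a)" by (simp add: diff_mult_distrib2[symmetric])
      then have "f dvd a' - a"
        using coprime_fib_Suc_nat[of k]
        by (simp add: f_def g_def coprime_commute coprime_dvd_mult_right_iff)
      moreover have "a' - a < f" using that(1,2) by (auto simp: P)
      ultimately have "a = a'" using that(4) by (auto dest: nat_dvd_not_less)
      then show ?thesis using that(3) f by simp
    qed
    fix a b a' b'
    assume "(a, b) \<in> P" "(a', b') \<in> P" "h (a, b) = h (a', b')"
    then show "a = a' \<and> b = b'"
      using *[of a b a' b'] *[of a' b' a b] by (cases "a \<le> a'") (auto simp: h_def)
  qed
  ultimately have "representable_count k N = card P"
    by (simp add: representable_count_def card_image)
  also have "\<dots> = (\<Sum>a = 1..f. (N - g * a) div f)" by (simp add: P_def)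
  finally show ?thesis unfolding f_def g_def .
qed

section \<open>Sums of floor quotients compared with areas\<close>

lemma of_nat_div_approx:
  fixes f m :: nat
  assumes "0 < f"
  shows "\<bar>real (m div f) - real m / real f\<bar> \<le> 1"
proof -
  have "real m = real f * real (m div f) + real (m mod f)"
    by (simp flip: of_nat_mult of_nat_add)
  then have "real m / real f = real (m div f) + real (m mod f) / real f"
    using assms by (simp add: field_simps)
  moreover have "0 \<le> real (m mod f) / real f" "real (m mod f) / real f \<le> 1"
    using assms by (simp_all add: less_imp_le)
  ultimately show ?thesis by linarith
qed

text \<open>Each quotient is within 1 of the exact fraction, and the exact fractions form an
  arithmetic progression. The condition \<open>g * A \<le> N\<close> keeps the natural subtraction
  from truncating.\<close>

lemma sum_div_approx:
  assumes "0 < f" "g * A \<le> N"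
  shows "\<bar>real (\<Sum>a = 1..A. (N - g * a) div f)
    - (real A * real N - real g * (real A * (real A + 1)) / 2) / real f\<bar> \<le> real A"
proof -
  have "(\<Sum>a = 1..A. real N - real g * real a) = real A * real N - real g * (\<Sum>a = 1..A. real a)"
    by (simp add: sum_subtractf sum_distrib_left)
  also have "(\<Sum>a = 1..A. real a) = real A * (real A + 1) / 2"
    by (induction A) (auto simp: field_simps)
  finally have "(real A * real N - real g * (real A * (real A + 1)) / 2) / real f
      = (\<Sum>a = 1..A. real N - real g * real a) / real f"
    by simp
  also have "\<dots> = (\<Sum>a = 1..A. (real N - real g * real a) / real f)"
    by (rule sum_divide_distrib)
  finally have "(real A * real N - real g * (real A * (real A + 1)) / 2) / real f
      = (\<Sum>a = 1..A. (real N - real g * real a) / real f)" .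
  then have "\<bar>real (\<Sum>a = 1..A. (N - g * a) div f)
      - (real A * real N - real g * (real A * (real A + 1)) / 2) / real f\<bar>
      = \<bar>\<Sum>a = 1..A. real ((N - g * a) div f) - (real N - real g * real a) / real f\<bar>"
    by (simp add: sum_subtractf)
  also have "\<dots> \<le> (\<Sum>a = 1..A. \<bar>real ((N - g * a) div f) - (real N - real g * real a) / real f\<bar>)"
    by (rule sum_abs)
  also have "\<dots> \<le> (\<Sum>a = 1..A. 1)"
  proof (rule sum_mono)
    fix a assume "a \<in> {1..A}"
    then have "g * a \<le> N" using assms(2) by (meson atLeastAtMost_iff le_trans mult_le_mono2)
    then have "real N - real g * real a = real (N - g * a)" by (simp add: of_nat_diff)
    then show "\<bar>real ((N - g * a) div f) - (real N - real g * real a) / real f\<bar> \<le> 1"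
      using of_nat_div_approx[OF assms(1)] by simp
  qed
  finally show ?thesis by simp
qed

text \<open>The line \<open>f * b + g * a = N\<close> stays above the axis up to
  \<open>a = f\<close>, so the main term is the area of a trapezoid. Rounding costs \<open>f\<close>
  and the linear term of the progression \<open>g / 2 \<le> f / 2\<close>.\<close>

lemma sum_div_approx_full:
  assumes "0 < f" "g \<le> f" "f * g \<le> N"
  shows "\<bar>real (\<Sum>a = 1..f. (N - g * a) div f) - (real N - real f * real g / 2)\<bar> \<le> 3 / 2 * real f"
proof -
  have "(real f * real N - real g * (real f * (real f + 1)) / 2) / real f
      = real N - real f * real g / 2 - real g / 2"
    using assms(1) by (simp add: field_simps)
  moreover have "g * f \<le> N" using assms(3) by (simp add: mult.commute)
  ultimately have "\<bar>real (\<Sum>a = 1..f. (N - g * a) div f) - (real N - real f * real g / 2 - real g / 2)\<bar>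
      \<le> real f"
    using sum_div_approx[OF assms(1)] by metis
  moreover have "real g \<le> real f" using assms(2) by simp
  ultimately show ?thesis unfolding abs_le_iff by linarith
qed

text \<open>Now the line meets the axis at \<open>N / g \<le> f\<close>; the columns beyond are
  empty, and the main term is the area of the triangle with legs \<open>N / f\<close> and
  \<open>N / g\<close>.\<close>

lemma sum_div_approx_cut:
  assumes "0 < g" "g \<le> f" "N \<le> f * g"
  shows "\<bar>real (\<Sum>a = 1..f. (N - g * a) div f) - (real N)\<^sup>2 / (2 * (real f * real g))\<bar>
    \<le> 2 * (real N / real g)"
proof -
  define A r where "A = N div g" and "r = N mod g"
  have f: "0 < f" using assms by simp
  have N: "real N = real g * real A + real r"
    unfolding A_def r_def by (simp flip: of_nat_mult of_nat_add)
  have "A \<le> f" unfolding A_def using assms by (metis div_le_mono nonzero_mult_div_cancel_right not_less0)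
  then have sum_eq: "(\<Sum>a = 1..f. (N - g * a) div f) = (\<Sum>a = 1..A. (N - g * a) div f)"
  proof (intro sum.mono_neutral_right ballI)
    fix a assume "a \<in> {1..f} - {1..A}"
    then have "N div g < a" by (auto simp: A_def)
    then have "N < g * a" using assms(1) by (simp add: div_less_iff_less_mult mult.commute)
    then show "(N - g * a) div f = 0" by simp
  qed auto
  define S q where "S = real (\<Sum>a = 1..A. (N - g * a) div f)" and "q = real N / real g"
  define X u v where "X = (real N)\<^sup>2 / (2 * (real f * real g))"
    and "u = (real r)\<^sup>2 / (2 * (real f * real g))" and "v = real g * real A / (2 * real f)"
  \<comment> \<open>Inserting \<open>N = g * A + r\<close> gives the triangle area \<open>X\<close>
    exactly, up to \<open>u\<close> and \<open>v\<close>. The total error \<open>A + u + v\<close>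
    is at most \<open>q + q / 2 + q / 2\<close>.\<close>
  have "(real A * real N - real g * (real A * (real A + 1)) / 2) / real f = X - u - v"
    unfolding X_def u_def v_def N using assms(1) f by (simp add: field_simps power2_eq_square)
  then have "\<bar>S - (X - u - v)\<bar> \<le> real A"
    using sum_div_approx[OF f, of g A N] unfolding S_def by (simp add: A_def)
  moreover have "real A \<le> q"
    unfolding A_def q_def by (rule of_nat_div_le_of_nat)
  moreover have "v \<le> real A / 2"
    unfolding v_def using assms f by (simp add: field_simps mult_left_mono)
  moreover have "u \<le> q / 2"
  proof -
    have "r \<le> f" using assms by (simp add: r_def) (meson mod_less_divisor le_trans less_imp_le)
    moreover have "r \<le> N" by (simp add: r_def)
    ultimately have "r * r \<le> N * f" by (rule mult_le_mono[rotated])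
    then have "(real r)\<^sup>2 \<le> real N * real f"
      unfolding power2_eq_square by (simp flip: of_nat_mult)
    then show ?thesis unfolding u_def q_def using assms(1) f by (simp add: field_simps)
  qed
  moreover have "0 \<le> u" "0 \<le> v" unfolding u_def v_def by simp_all
  ultimately have "\<bar>S - X\<bar> \<le> 2 * q" by linarith
  then show ?thesis unfolding sum_eq S_def X_def q_def .
qed

lemma representable_count_small:
  assumes "golden ^ (2 * k + 1) \<le> 5 * real N"
  shows "\<bar>real (representable_count k N) - (real N - golden ^ (2 * k + 1) / 10)\<bar> \<le> 2 * golden ^ k"
proof -
  define f g where "f = fib (Suc k)" and "g = fib k"
  have p: "\<bar>5 * (real f * real g) - golden ^ (2 * k + 1)\<bar> \<le> 2"
    unfolding f_def g_def by (rule fib_consecutive_product)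
  \<comment> \<open>The slack 2 is smaller than 5, so integrality upgrades this to
    \<open>f * g \<le> N\<close>.\<close>
  with assms have "5 * (real f * real g) \<le> 5 * real N + 2" by linarith
  then have "real (5 * (f * g)) \<le> real (5 * N + 2)" by simp
  then have "5 * (f * g) \<le> 5 * N + 2" by (simp only: of_nat_le_iff)
  then have "f * g \<le> N" by linarith
  then have "\<bar>real (representable_count k N) - (real N - real f * real g / 2)\<bar> \<le> 3 / 2 * real f"
    unfolding representable_count_eq_sum f_def g_def
    by (intro sum_div_approx_full) (auto simp: fib_neq_0_nat fib_Suc_mono)
  moreover have "real f \<le> golden ^ k" unfolding f_def by (rule fib_le_golden)
  ultimately show ?thesis using p golden_power_ge_1[of k] unfolding abs_le_iff by linarith
qed

lemma golden_le_4_fib: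
  assumes "1 \<le> k"
  shows "golden ^ k \<le> 4 * real (fib k)"
proof (cases k rule: fib.cases)
  case (3 j)
  have "golden ^ k = (golden + 1) * golden ^ j"
    unfolding 3 by (simp flip: mult.assoc add: golden_square)
  also have "\<dots> \<le> 4 * real (fib k)"
    unfolding 3 using golden_le_fib[of j] golden_lt_2 golden_pos golden_power_pos[of j]
    by (intro mult_mono) auto
  finally show ?thesis .
qed (use assms golden_lt_2 in auto)

text \<open>The cut sum costs \<open>2 * (N / g)\<close>, replacing \<open>5 * (f * g)\<close> by
  the power of \<open>golden\<close> costs another \<open>N / g\<close>, and
  \<open>golden_le_4_fib\<close> turns the total into \<open>12 * (N / golden ^ k)\<close>.\<close>

lemma representable_count_large:
  assumes "5 * real N < golden ^ (2 * k + 1)" "1 \<le> k"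
  shows "\<bar>real (representable_count k N) - 5 * (real N)\<^sup>2 / (2 * golden ^ (2 * k + 1))\<bar>
    \<le> 12 * (real N / golden ^ k)"
proof -
  define f g where "f = fib (Suc k)" and "g = fib k"
  define z where "z = golden ^ (2 * k + 1)"
  have f: "1 \<le> f" and g: "1 \<le> g"
    using fib_neq_0_nat[of k] fib_neq_0_nat[of "Suc k"] assms(2)
    by (simp_all add: f_def g_def Suc_le_eq del: fib.simps)
  have z: "0 < z" unfolding z_def by (rule golden_power_pos)
  have p: "\<bar>5 * (real f * real g) - z\<bar> \<le> 2"
    unfolding f_def g_def z_def by (rule fib_consecutive_product)
  then have "5 * real N < 5 * (real f * real g) + 2" using assms(1) unfolding z_def by linarith
  then have "real (5 * N) < real (5 * (f * g) + 2)" by simp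
  then have "5 * N < 5 * (f * g) + 2" by (simp only: of_nat_less_iff)
  then have "N \<le> f * g" by linarith
  then have "\<bar>real (representable_count k N) - (real N)\<^sup>2 / (2 * (real f * real g))\<bar>
      \<le> 2 * (real N / real g)"
    unfolding representable_count_eq_sum f_def g_def
    using g by (intro sum_div_approx_cut) (auto simp: g_def fib_Suc_mono)
  moreover have "\<bar>(real N)\<^sup>2 / (2 * (real f * real g)) - 5 * (real N)\<^sup>2 / (2 * z)\<bar>
      \<le> real N / real g"
  proof -
    have "(real N)\<^sup>2 / (2 * (real f * real g)) - 5 * (real N)\<^sup>2 / (2 * z)
        = (real N / real g) * (real N / (real f * z)) * ((z - 5 * (real f * real g)) / 2)"
      using f g z by (simp add: field_simps power2_eq_square)
    also have "\<bar>\<dots>\<bar> = (real N / real g) * ((real N / (real f * z)) * (\<bar>z - 5 * (real f * real g)\<bar> / 2))"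
      using z by (simp add: abs_mult)
    also have "\<dots> \<le> (real N / real g) * (1 * 1)"
    proof (intro mult_left_mono mult_mono)
      have "real N \<le> 1 * z" using assms(1) by (simp add: z_def)
      also have "\<dots> \<le> real f * z" using f z by (intro mult_right_mono) auto
      finally show "real N / (real f * z) \<le> 1" using f z by (simp add: field_simps)
      show "\<bar>z - 5 * (real f * real g)\<bar> / 2 \<le> 1" using p by (simp add: abs_minus_commute)
    qed (use z in auto)
    finally show ?thesis by simp
  qed
  moreover have "real N / real g \<le> 4 * (real N / golden ^ k)"
  proof -
    have "real N * golden ^ k \<le> real N * (4 * real g)"
      unfolding g_def using golden_le_4_fib[OF assms(2)] by (intro mult_left_mono) auto
    then show ?thesis using g golden_power_pos[of k] by (simp add: field_simps)
  qed
  ultimately show ?thesis unfolding z_def abs_le_iff by linarith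
qed

subsection \<open>Summation\<close>

text \<open>The induction proves the bound \<open>golden ^ (M + 2)\<close>, which the Fibonacci
  recurrence reproduces.\<close>

lemma sum_golden_power_le: "(\<Sum>k = 1..M. golden ^ k) \<le> 4 * golden ^ M"
proof -
  have "(\<Sum>k = 1..M. golden ^ k) \<le> golden ^ Suc (Suc M)"
  proof (induction M)
    case (Suc M)
    then show ?case using golden_Suc_Suc[of "Suc M"] by simp
  qed (simp add: golden_pos less_imp_le)
  also have "\<dots> = (golden + 1) * golden ^ M" by (simp flip: mult.assoc add: golden_square)
  also have "\<dots> \<le> 4 * golden ^ M"
    using golden_lt_2 golden_power_pos[of M] by (intro mult_right_mono) auto
  finally show ?thesis .
qed

lemma sum_inverse_golden_power_le:
  assumes "M \<le> K"
  shows "(\<Sum>k = Suc M..K. 1 / golden ^ k) \<le> 2 / golden ^ M"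
proof -
  have "(\<Sum>k = Suc M..K. 1 / golden ^ k) = golden / golden ^ M - golden / golden ^ K"
    using assms
  proof (induction K rule: dec_induct)
    case (step K)
    have "1 / golden ^ Suc K = golden / golden ^ K - golden / golden ^ Suc K"
      using golden_pos golden_square by (simp add: field_simps)
    then show ?case using step by simp
  qed simp
  also have "\<dots> \<le> golden / golden ^ M"
    using golden_pos by simp
  also have "\<dots> \<le> 2 / golden ^ M"
    using golden_lt_2 golden_power_pos[of M] by (intro divide_right_mono) auto
  finally show ?thesis .
qed

text \<open>The alternating series below have ratio \<open>-(golden ^ 2)\<close> or its inverse, so
  this is the denominator \<open>1 + golden ^ 2\<close> of their closed forms.\<close>

lemma sqrt5_times_golden: "sqrt 5 * golden = golden * golden + 1"
  using golden_square unfolding sqrt5_golden by (simp add: algebra_simps)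

lemma alternating_sum_golden:
  "sqrt 5 * (\<Sum>k = 1..M. (- 1) ^ (k + 1) * golden ^ (2 * k + 1))
    = golden * (golden - (- 1) ^ M * golden ^ (2 * M + 1))"
proof (induction M)
  case (Suc M)
  have "sqrt 5 * golden ^ (2 * Suc M + 1) = golden ^ (2 * M + 2) * (sqrt 5 * golden)"
    by simp
  also have "\<dots> = golden * (golden ^ (2 * Suc M + 1) + golden ^ (2 * M + 1))"
    unfolding sqrt5_times_golden by (simp add: algebra_simps)
  finally have "sqrt 5 * ((- 1) ^ (Suc M + 1) * golden ^ (2 * Suc M + 1))
      = (- 1) ^ M * (golden * (golden ^ (2 * Suc M + 1) + golden ^ (2 * M + 1)))"
    by (simp add: mult.left_commute)
  then show ?case using Suc by (simp add: distrib_left right_diff_distrib mult.left_commute)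
qed simp

lemma alternating_sum_inverse_golden:
  assumes "M \<le> K"
  shows "sqrt 5 * golden * (\<Sum>k = Suc M..K. (- 1) ^ (k + 1) / golden ^ (2 * k + 1))
    = (- 1) ^ M / golden ^ (2 * M + 1) - (- 1) ^ K / golden ^ (2 * K + 1)"
  using assms
proof (induction K rule: dec_induct)
  case (step K)
  have "sqrt 5 * golden / golden ^ (2 * Suc K + 1)
      = 1 / golden ^ (2 * K + 1) + 1 / golden ^ (2 * Suc K + 1)"
    unfolding sqrt5_times_golden using golden_pos by (simp add: field_simps)
  moreover have "sqrt 5 * golden * ((- 1) ^ (Suc K + 1) / golden ^ (2 * Suc K + 1))
      = (- 1) ^ K * (sqrt 5 * golden / golden ^ (2 * Suc K + 1))"
    by simp
  ultimately have "sqrt 5 * golden * ((- 1) ^ (Suc K + 1) / golden ^ (2 * Suc K + 1))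
      = (- 1) ^ K * (1 / golden ^ (2 * K + 1) + 1 / golden ^ (2 * Suc K + 1))"
    by metis
  then show ?case using step by (simp add: distrib_left)
qed simp

text \<open>\<open>M\<close> is the switch between the two estimates: indices up to \<open>M\<close>
  fall under \<open>representable_count_small\<close>, later ones under
  \<open>representable_count_large\<close>. The alternating sum of \<open>N\<close> leaves
  \<open>N\<close> or 0, and each geometric series contributes its end at the switch.\<close>

lemma card_down_integers_approx:
  fixes N M :: nat
  defines "y \<equiv> golden ^ (2 * M + 1)"
  assumes N: "1 \<le> N" and lower: "y \<le> 5 * real N" and upper: "5 * real N < golden ^ (2 * M + 3)"
  shows "\<bar>real (card (down_integers \<inter> {1..N}))
      - (of_bool (odd M) * real N
          + (- 1) ^ M * (golden * y / (10 * sqrt 5) + sqrt 5 * (real N)\<^sup>2 / (2 * golden * y)))\<bar>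
    \<le> 75 * sqrt (real N)"
proof -
  \<comment> \<open>With \<open>N < golden ^ K\<close> the cutoff \<open>K\<close> covers every
    slowness that occurs and makes the far end of the inverse series at most 1.\<close>
  obtain K0 where K0: "real N < golden ^ K0" using real_arch_pow[OF golden_gt_1] by blast
  define K where "K = M + K0"
  have MK: "M \<le> K" by (simp add: K_def)
  have "golden ^ K0 \<le> golden ^ K" using golden_gt_1 by (simp add: K_def)
  with K0 have K: "real N \<le> golden ^ K" "real N < golden ^ K" by auto
  define z where "z = golden ^ (2 * K + 1)"
  define R where "R k = real (representable_count k N)" for k
  define h where "h k = (if k \<le> M then real N - golden ^ (2 * k + 1) / 10
    else 5 * (real N)\<^sup>2 / (2 * golden ^ (2 * k + 1)))" for k
  define A1 where "A1 = (\<Sum>k = 1..M. (- 1) ^ (k + 1) * golden ^ (2 * k + 1))"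
  define A2 where "A2 = (\<Sum>k = Suc M..K. (- 1) ^ (k + 1) / golden ^ (2 * k + 1))"
  have split: "(\<Sum>k = 1..K. F k) = (\<Sum>k = 1..M. F k) + (\<Sum>k = Suc M..K. F k)"
    for F :: "nat \<Rightarrow> real"
    using sum.ub_add_nat[of 1 M F K0] by (simp add: K_def)
  have y: "0 < y" and z: "0 < z" unfolding y_def z_def by (rule golden_power_pos)+
  have sN: "1 \<le> sqrt (real N)" "sqrt (real N) * sqrt (real N) = real N" using N by simp_all
  have M_le: "golden ^ M \<le> 3 * sqrt (real N)"
  proof -
    have "(golden ^ M)\<^sup>2 \<le> y"
      unfolding y_def power_mult[symmetric] using golden_gt_1 by (intro power_increasing) auto
    also have "\<dots> \<le> (3 * sqrt (real N))\<^sup>2" using lower by (simp add: power_mult_distrib)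
    finally show ?thesis by (rule power2_le_imp_le) (use sN in simp)
  qed
  have M_ge: "sqrt (real N) \<le> 2 * golden ^ M"
  proof -
    have "golden ^ (2 * M + 3) = (golden * golden) * golden * golden ^ (2 * M)"
      by (simp add: eval_nat_numeral)
    also have "\<dots> \<le> 3 * 2 * golden ^ (2 * M)"
      unfolding golden_square using golden_lt_2 golden_pos
      by (intro mult_mono) auto
    finally have "real N \<le> (2 * golden ^ M)\<^sup>2"
      using upper golden_power_pos[of "2 * M"] by (simp add: power_mult_distrib flip: power_mult) (simp add: mult.commute)
    then show ?thesis using golden_power_pos[of M] by (simp add: real_le_lsqrt)
  qed

  have "\<bar>(\<Sum>k = 1..K. (- 1) ^ (k + 1) * R k) - (\<Sum>k = 1..K. (- 1) ^ (k + 1) * h k)\<bar>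
      = \<bar>\<Sum>k = 1..K. (- 1) ^ (k + 1) * (R k - h k)\<bar>"
    by (simp only: sum_subtractf right_diff_distrib)
  also have "\<dots> \<le> (\<Sum>k = 1..K. \<bar>(- 1) ^ (k + 1) * (R k - h k)\<bar>)" by (rule sum_abs)
  also have "\<dots> = (\<Sum>k = 1..M. \<bar>R k - h k\<bar>) + (\<Sum>k = Suc M..K. \<bar>R k - h k\<bar>)"
    unfolding split by (simp add: abs_mult)
  also have "(\<Sum>k = 1..M. \<bar>R k - h k\<bar>) \<le> (\<Sum>k = 1..M. 2 * golden ^ k)"
  proof (rule sum_mono)
    fix k assume k: "k \<in> {1..M}"
    then have "golden ^ (2 * k + 1) \<le> y"
      unfolding y_def using golden_gt_1 by (intro power_increasing) auto
    with lower have "golden ^ (2 * k + 1) \<le> 5 * real N" by linarith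
    from representable_count_small[OF this] show "\<bar>R k - h k\<bar> \<le> 2 * golden ^ k"
      using k by (simp add: R_def h_def)
  qed
  \<comment> \<open>Here 24 is 2 * 4 * 3: the single estimate, \<open>sum_golden_power_le\<close>
    and \<open>M_le\<close>. Likewise 48 below is 12 * 2 * 2, with
    \<open>sum_inverse_golden_power_le\<close> and \<open>M_ge\<close>.\<close>
  also have "(\<Sum>k = 1..M. 2 * golden ^ k) \<le> 24 * sqrt (real N)"
    unfolding sum_distrib_left[symmetric] using sum_golden_power_le[of M] M_le by linarith
  also have "(\<Sum>k = Suc M..K. \<bar>R k - h k\<bar>) \<le> (\<Sum>k = Suc M..K. 12 * real N * (1 / golden ^ k))"
  proof (rule sum_mono)
    fix k assume k: "k \<in> {Suc M..K}"
    then have "golden ^ (2 * M + 3) \<le> golden ^ (2 * k + 1)"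
      using golden_gt_1 by (intro power_increasing) auto
    with upper have "5 * real N < golden ^ (2 * k + 1)" by linarith
    from representable_count_large[OF this] show "\<bar>R k - h k\<bar> \<le> 12 * real N * (1 / golden ^ k)"
      using k by (simp add: R_def h_def)
  qed
  also have "\<dots> \<le> 12 * real N * (2 / golden ^ M)"
    unfolding sum_distrib_left[symmetric]
    by (intro mult_left_mono sum_inverse_golden_power_le[OF MK]) simp
  also have "\<dots> \<le> 48 * sqrt (real N)"
  proof -
    have "real N \<le> sqrt (real N) * (2 * golden ^ M)"
      using M_ge sN by (metis mult_left_mono order.trans zero_le_one)
    then show ?thesis using golden_power_pos[of M] by (simp add: field_simps)
  qed
  finally have error: "\<bar>(\<Sum>k = 1..K. (- 1) ^ (k + 1) * R k) - (\<Sum>k = 1..K. (- 1) ^ (k + 1) * h k)\<bar>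
      \<le> 24 * sqrt (real N) + 48 * sqrt (real N)" by simp

  have "N < fib (Suc (Suc (Suc K)))"
  proof -
    have "real N < golden ^ Suc K"
      using K golden_gt_1 golden_power_pos[of K] by (simp add: less_1_mult order.strict_trans)
    then have "real N < real (fib (Suc (Suc (Suc K))))" using golden_le_fib[of "Suc K"] by linarith
    then show ?thesis by (simp only: of_nat_less_iff)
  qed
  note card = card_down_integers[OF this, folded R_def]

  have A1: "A1 = golden * (golden - (- 1) ^ M * y) / sqrt 5"
    using alternating_sum_golden[of M] unfolding A1_def[symmetric] y_def[symmetric]
    by (simp add: field_simps)
  have A2: "A2 = ((- 1) ^ M / y - (- 1) ^ K / z) / (sqrt 5 * golden)"
    using alternating_sum_inverse_golden[OF MK] golden_pos
    unfolding A2_def[symmetric] y_def[symmetric] z_def[symmetric]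
    by (simp add: field_simps)
  have "(\<Sum>k = 1..M. (- 1) ^ (k + 1) * h k)
      = (\<Sum>k = 1..M. (- 1) ^ (k + 1) * real N - (- 1) ^ (k + 1) * golden ^ (2 * k + 1) / 10)"
  proof (rule sum.cong[OF refl])
    fix k assume "k \<in> {1..M}"
    then have "h k = real N - golden ^ (2 * k + 1) / 10" by (simp add: h_def)
    then show "(- 1) ^ (k + 1) * h k
        = (- 1) ^ (k + 1) * real N - (- 1) ^ (k + 1) * golden ^ (2 * k + 1) / 10"
      by (simp only: right_diff_distrib times_divide_eq_right)
  qed
  also have "\<dots> = (\<Sum>k = 1..M. (- 1) ^ (k + 1)) * real N - A1 / 10"
    unfolding A1_def sum_subtractf sum_distrib_right sum_divide_distrib ..
  finally have "(\<Sum>k = 1..M. (- 1) ^ (k + 1) * h k)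
      = (\<Sum>k = 1..M. (- 1) ^ (k + 1)) * real N - A1 / 10" .
  moreover have "(\<Sum>k = Suc M..K. (- 1) ^ (k + 1) * h k) = 5 * (real N)\<^sup>2 / 2 * A2"
    unfolding A2_def sum_distrib_left by (intro sum.cong) (auto simp: h_def)
  ultimately have main: "(\<Sum>k = 1..K. (- 1) ^ (k + 1) * h k)
      = of_bool (odd M) * real N - A1 / 10 + 5 * (real N)\<^sup>2 / 2 * A2"
    unfolding split sum_minus_one_power by simp
  \<comment> \<open>\<open>t1\<close> and \<open>t2\<close> are the ends of the two geometric series
    away from the switch. Each is at most 1, so that 24 + 48 + 1 + 1 fits into 75.\<close>
  define t1 where "t1 = golden * golden / (10 * sqrt 5)"
  have A1_eq: "A1 / 10 = t1 - (- 1) ^ M * (golden * y / (10 * sqrt 5))"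
    unfolding A1 t1_def by (simp add: field_simps)
  define t2 where "t2 = (- 1) ^ K * (sqrt 5 * (real N)\<^sup>2 / (2 * golden * z))"
  have A2_eq: "5 * (real N)\<^sup>2 / 2 * A2 = (- 1) ^ M * (sqrt 5 * (real N)\<^sup>2 / (2 * golden * y)) - t2"
  proof -
    have "5 * (real N)\<^sup>2 / 2 * A2
        = (5 / sqrt 5) * ((real N)\<^sup>2 / (2 * golden) * ((- 1) ^ M / y - (- 1) ^ K / z))"
      unfolding A2 by (simp add: ac_simps)
    also have "\<dots> = (- 1) ^ M * (sqrt 5 * (real N)\<^sup>2 / (2 * golden * y))
      - (- 1) ^ K * (sqrt 5 * (real N)\<^sup>2 / (2 * golden * z))"
      unfolding real_div_sqrt[of 5, simplified] by (simp add: algebra_simps)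
    finally show ?thesis unfolding t2_def .
  qed
  have t1: "\<bar>t1\<bar> \<le> 1"
  proof -
    have "1 \<le> sqrt 5" by simp
    then have "golden * golden \<le> 10 * sqrt 5" using golden_lt_2 unfolding golden_square by linarith
    then show ?thesis unfolding t1_def using golden_pos by simp
  qed
  have t2: "\<bar>t2\<bar> \<le> 1"
  proof -
    have "(real N)\<^sup>2 \<le> (golden ^ K)\<^sup>2" using K by (intro power_mono) auto
    also have "\<dots> \<le> z"
      unfolding z_def power_mult[symmetric] using golden_gt_1 by (intro power_increasing) auto
    finally have "sqrt 5 * (real N)\<^sup>2 \<le> (2 * golden) * z"
      unfolding sqrt5_golden using golden_gt_1 by (intro mult_mono) auto
    then show ?thesis unfolding t2_def using golden_pos z by (simp add: abs_mult field_simps)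
  qed
  define X where "X = of_bool (odd M) * real N
      + (- 1) ^ M * (golden * y / (10 * sqrt 5) + sqrt 5 * (real N)\<^sup>2 / (2 * golden * y))"
  have "(\<Sum>k = 1..K. (- 1) ^ (k + 1) * h k) = X - t1 - t2"
    unfolding main A1_eq A2_eq X_def distrib_left by simp
  with error t1 t2 sN(1)
  have "\<bar>(\<Sum>k = 1..K. (- 1) ^ (k + 1) * R k) - X\<bar> \<le> 75 * sqrt (real N)" by linarith
  then show ?thesis unfolding card X_def .
qed

section \<open>From \<open>p\<close> and \<open>c\<close> to the switch index\<close>

lemma golden_powi_cases:
  fixes n :: nat and p :: int and c :: real
  assumes n: "1 \<le> n" "real n = 1 / sqrt 5 * c * golden powi p"
    and c: "1 / sqrt 5 \<le> c" "c < 1 / sqrt 5 * golden"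
  obtains M where "p = 2 * int M + 1 \<or> p = 2 * int M + 2"
    "golden powi p \<le> 5 * real n" "5 * real n < golden * golden powi p"
    "0 < c" "sqrt 5 * real n = c * golden powi p"
proof -
  define E where "E = golden powi p"
  have E: "0 < E" using golden_pos by (simp add: E_def)
  have c0: "0 < c" using c(1) by (rule less_le_trans[rotated]) simp
  have eq: "sqrt 5 * real n = c * E" using n(2) by (simp add: E_def)
  then have 5: "5 * real n = (sqrt 5 * c) * E" by (metis abs_numeral mult.assoc real_sqrt_mult_self)
  \<comment> \<open>The range of \<open>c\<close> makes \<open>golden powi p\<close> the largest
    power of \<open>golden\<close> not above \<open>5 * n\<close>. As \<open>5 * n\<close> exceeds
    \<open>golden\<close>, the exponent is positive and can be written with a natural
    \<open>M\<close>.\<close>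
  have "1 \<le> sqrt 5 * c" "sqrt 5 * c < golden" using c by (simp_all add: field_simps)
  then have lu: "E \<le> 5 * real n" "5 * real n < golden * E"
    unfolding 5 using E by (simp_all add: mult_strict_right_mono)
  have "0 < p"
  proof (rule ccontr)
    assume "\<not> 0 < p"
    then have "E \<le> golden powi 0"
      unfolding E_def using golden_gt_1 by (intro power_int_increasing) auto
    then have "golden * E \<le> golden * 1" using golden_pos by (intro mult_left_mono) auto
    moreover have "5 \<le> 5 * real n" using n(1) by simp
    ultimately show False using lu golden_lt_2 by linarith
  qed
  then have "p = 2 * ((p - 1) div 2) + 1 \<or> p = 2 * ((p - 1) div 2) + 2" "0 \<le> (p - 1) div 2"
    by presburger+
  then have "p = 2 * int (nat ((p - 1) div 2)) + 1 \<or> p = 2 * int (nat ((p - 1) div 2)) + 2"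
    by simp
  then show ?thesis using that lu c0 eq unfolding E_def by blast
qed

lemma down_density_approx:
  assumes "1 \<le> n" and "\<bar>real (card (down_integers \<inter> {1..n})) - X\<bar> \<le> C * sqrt (real n)"
    and "X = real n * d"
  shows "\<bar>down_density n - d\<bar> \<le> C * real n powr (-1/2)"
proof -
  have n: "0 < real n" using assms(1) by simp
  have "down_density n - d = (real (card (down_integers \<inter> {1..n})) - X) / real n"
    unfolding down_density_def assms(3) using n by (simp add: field_simps)
  then have "\<bar>down_density n - d\<bar> \<le> C * sqrt (real n) / real n"
    using assms(2) n by (simp add: divide_right_mono)
  also have "\<dots> = C * real n powr (-1/2)"
    using n by (simp add: powr_minus powr_half_sqrt real_div_sqrt field_simps)
  finally show ?thesis .
qed


theorem theorem3:
  "\<exists>C::real. \<forall>(n::nat) (p::int) (c::real).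
     1 \<le> n \<longrightarrow> real n = 1 / sqrt 5 * c * golden powi p \<longrightarrow>
     1 / sqrt 5 \<le> c \<longrightarrow> c < 1 / sqrt 5 * golden \<longrightarrow>
       (p mod 4 = 0 \<longrightarrow>
          \<bar>down_density n - (1 - 1/2 * c - 1 / (10 * c))\<bar> \<le> C * real n powr (-1/2)) \<and>
       (p mod 4 = 1 \<longrightarrow>
          \<bar>down_density n - (1 / (2 * golden) * c + golden / (10 * c))\<bar> \<le> C * real n powr (-1/2)) \<and>
       (p mod 4 = 2 \<longrightarrow>
          \<bar>down_density n - (1/2 * c + 1 / (10 * c))\<bar> \<le> C * real n powr (-1/2)) \<and>
       (p mod 4 = 3 \<longrightarrow>
          \<bar>down_density n - (1 - 1 / (2 * golden) * c - golden / (10 * c))\<bar> \<le> C * real n powr (-1/2))"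
proof (rule exI[of _ 75], intro allI impI)
  fix n :: nat and p :: int and c :: real
  assume n: "1 \<le> n" "real n = 1 / sqrt 5 * c * golden powi p"
    and c: "1 / sqrt 5 \<le> c" "c < 1 / sqrt 5 * golden"
  obtain M where M: "p = 2 * int M + 1 \<or> p = 2 * int M + 2"
    and lower: "golden powi p \<le> 5 * real n" and upper: "5 * real n < golden * golden powi p"
    and c0: "0 < c" and eq: "sqrt 5 * real n = c * golden powi p"
    using golden_powi_cases[OF n c] .
  define y where "y = golden ^ (2 * M + 1)"
  have y: "0 < y" unfolding y_def by (rule golden_power_pos)
  define d where "d = golden * y / (10 * sqrt 5) + sqrt 5 * (real n)\<^sup>2 / (2 * golden * y)"
  have density: "\<bar>down_density n - (of_bool (odd M) + (- 1) ^ M * e)\<bar> \<le> 75 * real n powr (-1/2)"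
    if "y \<le> 5 * real n" "5 * real n < golden ^ (2 * M + 3)" "d = real n * e" for e
    using n(1) card_down_integers_approx[OF n(1) that(1,2)[unfolded y_def], folded y_def, folded d_def]
    by (rule down_density_approx) (simp add: that(3) algebra_simps)
  \<comment> \<open>The parity of \<open>p\<close> decides whether \<open>y\<close> or
    \<open>golden * y\<close> equals \<open>golden powi p\<close>, hence the shape
    \<open>e = d / n\<close> in terms of \<open>c\<close>. The parity of \<open>M\<close> decides
    between \<open>e\<close> and \<open>1 - e\<close>. Together they give the four residues.\<close>
  from M show "(p mod 4 = 0 \<longrightarrow>
          \<bar>down_density n - (1 - 1/2 * c - 1 / (10 * c))\<bar> \<le> 75 * real n powr (-1/2)) \<and>
       (p mod 4 = 1 \<longrightarrow>
          \<bar>down_density n - (1 / (2 * golden) * c + golden / (10 * c))\<bar> \<le> 75 * real n powr (-1/2)) \<and>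
       (p mod 4 = 2 \<longrightarrow>
          \<bar>down_density n - (1/2 * c + 1 / (10 * c))\<bar> \<le> 75 * real n powr (-1/2)) \<and>
       (p mod 4 = 3 \<longrightarrow>
          \<bar>down_density n - (1 - 1 / (2 * golden) * c - golden / (10 * c))\<bar> \<le> 75 * real n powr (-1/2))"
  proof
    assume p: "p = 2 * int M + 1"
    have "nat p = 2 * M + 1" using p by simp
    then have E: "golden powi p = y" using p by (simp add: power_int_def y_def)
    have yn: "y = sqrt 5 * real n / c" using eq c0 unfolding E by (simp add: field_simps)
    have "d = real n * (1 / (2 * golden) * c + golden / (10 * c))"
      unfolding d_def yn using c0 n(1) golden_pos by (simp add: field_simps power2_eq_square)
    moreover have "golden * y \<le> golden ^ (2 * M + 3)"
      using golden_gt_1 unfolding y_def power_Suc[symmetric] by (intro power_increasing) auto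
    ultimately have "\<bar>down_density n
        - (of_bool (odd M) + (- 1) ^ M * (1 / (2 * golden) * c + golden / (10 * c)))\<bar>
        \<le> 75 * real n powr (-1/2)"
      using lower upper unfolding E by (intro density) auto
    moreover have "p mod 4 = (if even M then 1 else 3)" using p by presburger
    ultimately show ?thesis by (cases "even M") (simp_all add: algebra_simps)
  next
    assume p: "p = 2 * int M + 2"
    have "nat p = 2 * M + 2" using p by simp
    then have E: "golden powi p = golden * y" using p by (simp add: power_int_def y_def)
    have yn: "golden * y = sqrt 5 * real n / c" using eq c0 unfolding E by (simp add: field_simps)
    have "d = real n * (1/2 * c + 1 / (10 * c))"
      unfolding d_def mult.assoc yn using c0 n(1) by (simp add: field_simps power2_eq_square)
    moreover have "golden * (golden * y) = golden ^ (2 * M + 3)"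
      by (simp add: y_def eval_nat_numeral)
    moreover have "y \<le> golden * y" using golden_gt_1 y by simp
    ultimately have "\<bar>down_density n - (of_bool (odd M) + (- 1) ^ M * (1/2 * c + 1 / (10 * c)))\<bar>
        \<le> 75 * real n powr (-1/2)"
      using lower upper unfolding E by (intro density) auto
    moreover have "p mod 4 = (if even M then 2 else 0)" using p by presburger
    ultimately show ?thesis by (cases "even M") (simp_all add: algebra_simps)
  qed
qed

end
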